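(* Let $G=(V,E)$ be a finite graph, $x\in V$, $q\geqslant1$ an integer, $\beta>0$, $\pmb{J}=(J_{ij})\in[0,\infty)^E$, $p_{ij}=1-\exp(-q\beta J_{ij})$ and $\pmb{\hat h}=(h_{i,p}:i\in V,\ p=1,\dots,q)$ a real magnetic field. For each $m\in\{1,\dots,q\}$, $$\pi_{q\beta,\pmb{\hat h},q,V}(\hat\sigma_x=m)=\phi_{\pmb{p},\pmb{\hat h},q,G}\left(\frac{\exp\big(\beta\sum_{i\in K_t}h_{i,m}\big)}{\sum_{p=1}^q\exp\big(\beta\sum_{i\in K_t}h_{i,p}\big)}\right),$$ where $K_t=K_t(\omega)$ is the open connected component of $x$.
   Context: Potts measure with free boundary condition at inverse temperature $\beta'>0$: $\pi_{\beta',\pmb{\hat h},q,V}(\hat\sigma)\propto\exp\big(\beta'\sum_{\{i,j\}\in E}J_{ij}\delta_{\hat\sigma_i,\hat\sigma_j}+\beta'\sum_{p=1}^q\sum_{i\in V}\frac{h_{i,p}}{q}\delta_{\hat\sigma_i,p}\big)$ on $\{1,\dots,q\}^V$, normalized to be a probability (it is used here with $\beta'=q\beta$). For $\omega\in\{0,1\}^E$, $\eta(\omega)=\{e:\omega_e=1\}$ is the set of open edges and $K_1,\dots,K_{k(\omega,G)}$ are the (vertex sets of the) connected components of $(V,\eta(\omega))$. With $B_{\pmb{J},q}(\omega)=\prod_{\{i,j\}:\omega_{ij}=1}p_{ij}\prod_{\{i,j\}:\omega_{ij}=0}(1-p_{ij})$, the random-cluster measure is $\phi_{\pmb{p},\pmb{\hat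 h},q,G}(\omega)\propto B_{\pmb{J},q}(\omega)\prod_{\alpha=1}^{k(\omega,G)}\sum_{p=1}^q\exp\big(\beta\sum_{i\in K_\alpha}h_{i,p}\big)$, normalized to be a probability on $\{0,1\}^E$. $\phi(f)$ denotes the expectation of $f$ under $\phi$. *)

theory Defs
  imports "HOL-Probability.Probability"
begin

text \<open>Finite simple graphs: vertex set \<open>V\<close>, and edges as two-element subsets of \<open>V\<close>.\<close>

definition finite_graph :: "'v set \<Rightarrow> 'v set set \<Rightarrow> bool" where
  "finite_graph V E \<longleftrightarrow> finite V \<and> (\<forall>e\<in>E. e \<subseteq> V \<and> card e = 2)"

definition gibbs_measure :: "'c set \<Rightarrow> ('c \<Rightarrow> real) \<Rightarrow> 'c measure" where
  "gibbs_measure \<Omega> w = point_measure \<Omega> (\<lambda>\<omega>. ennreal (w \<omega> / (\<Sum>\<omega>'\<in>\<Omega>. w \<omega>')))"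

definition spin_configs :: "'v set \<Rightarrow> nat \<Rightarrow> ('v \<Rightarrow> nat) set" where
  "spin_configs V q = V \<rightarrow>\<^sub>E {1..q}"

text \<open>For an edge \<open>e = {i, j}\<close> this is the Kronecker delta of \<open>\<sigma> i\<close> and \<open>\<sigma> j\<close>.\<close>

definition edge_delta :: "('v \<Rightarrow> nat) \<Rightarrow> 'v set \<Rightarrow> real" where
  "edge_delta \<sigma> e = of_bool (\<forall>i\<in>e. \<forall>j\<in>e. \<sigma> i = \<sigma> j)"

definition potts_weight ::
  "'v set \<Rightarrow> 'v set set \<Rightarrow> ('v set \<Rightarrow> real) \<Rightarrow> real \<Rightarrow> ('v \<Rightarrow> nat \<Rightarrow> real) \<Rightarrow> nat \<Rightarrow> ('v \<Rightarrow> nat) \<Rightarrow> real" where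
  "potts_weight V E J \<beta>' h q \<sigma> =
     exp (\<beta>' * (\<Sum>e\<in>E. J e * edge_delta \<sigma> e)
        + \<beta>' * (\<Sum>p=1..q. \<Sum>i\<in>V. h i p / real q * of_bool (\<sigma> i = p)))"

definition potts_measure ::
  "'v set \<Rightarrow> 'v set set \<Rightarrow> ('v set \<Rightarrow> real) \<Rightarrow> real \<Rightarrow> ('v \<Rightarrow> nat \<Rightarrow> real) \<Rightarrow> nat \<Rightarrow> ('v \<Rightarrow> nat) measure" where
  "potts_measure V E J \<beta>' h q = gibbs_measure (spin_configs V q) (potts_weight V E J \<beta>' h q)"

definition edge_configs :: "'v set set \<Rightarrow> ('v set \<Rightarrow> nat) set" where
  "edge_configs E = E \<rightarrow>\<^sub>E {0, 1}"

definition open_edges :: "'v set set \<Rightarrow> ('v set \<Rightarrow> nat) \<Rightarrow> 'v set set" where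
  "open_edges E \<omega> = {e \<in> E. \<omega> e = 1}"

definition open_component :: "'v set \<Rightarrow> 'v set set \<Rightarrow> ('v set \<Rightarrow> nat) \<Rightarrow> 'v \<Rightarrow> 'v set" where
  "open_component V E \<omega> x = {y \<in> V. (x, y) \<in> {(i, j). {i, j} \<in> open_edges E \<omega>}\<^sup>*}"

definition open_components :: "'v set \<Rightarrow> 'v set set \<Rightarrow> ('v set \<Rightarrow> nat) \<Rightarrow> 'v set set" where
  "open_components V E \<omega> = open_component V E \<omega> ` V"

definition bernoulli_factor :: "'v set set \<Rightarrow> ('v set \<Rightarrow> real) \<Rightarrow> ('v set \<Rightarrow> nat) \<Rightarrow> real" where
  "bernoulli_factor E p \<omega> = (\<Prod>e\<in>{e \<in> E. \<omega> e = 1}. p e) * (\<Prod>e\<in>{e \<in> E. \<omega> e = 0}. 1 - p e)"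

definition random_cluster_weight ::
  "'v set \<Rightarrow> 'v set set \<Rightarrow> ('v set \<Rightarrow> real) \<Rightarrow> real \<Rightarrow> ('v \<Rightarrow> nat \<Rightarrow> real) \<Rightarrow> nat \<Rightarrow> ('v set \<Rightarrow> nat) \<Rightarrow> real" where
  "random_cluster_weight V E p \<beta> h q \<omega> =
     bernoulli_factor E p \<omega> *
     (\<Prod>K\<in>open_components V E \<omega>. \<Sum>s=1..q. exp (\<beta> * (\<Sum>i\<in>K. h i s)))"

definition random_cluster_measure ::
  "'v set \<Rightarrow> 'v set set \<Rightarrow> ('v set \<Rightarrow> real) \<Rightarrow> real \<Rightarrow> ('v \<Rightarrow> nat \<Rightarrow> real) \<Rightarrow> nat \<Rightarrow> ('v set \<Rightarrow> nat) measure" where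
  "random_cluster_measure V E p \<beta> h q =
     gibbs_measure (edge_configs E) (random_cluster_weight V E p \<beta> h q)"

lemma prob_space_gibbs_measure:
  assumes "finite \<Omega>" and nn: "\<And>\<omega>. \<omega> \<in> \<Omega> \<Longrightarrow> w \<omega> \<ge> 0" and pos: "\<exists>\<omega>\<in>\<Omega>. w \<omega> > 0"
  shows "prob_space (gibbs_measure \<Omega> w)"
proof -
  have Z: "(\<Sum>\<omega>\<in>\<Omega>. w \<omega>) > 0"
    using assms by (meson sum_pos2)
  have "emeasure (point_measure \<Omega> (\<lambda>\<omega>. ennreal (w \<omega> / sum w \<Omega>))) \<Omega>
        = (\<Sum>\<omega>\<in>\<Omega>. ennreal (w \<omega> / sum w \<Omega>))"
    using \<open>finite \<Omega>\<close> by (simp add: emeasure_point_measure_finite)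
  also have "\<dots> = ennreal (\<Sum>\<omega>\<in>\<Omega>. w \<omega> / sum w \<Omega>)"
    using nn Z by (intro sum_ennreal) auto
  also have "(\<Sum>\<omega>\<in>\<Omega>. w \<omega> / sum w \<Omega>) = 1"
    using Z by (simp flip: sum_divide_distrib)
  finally show ?thesis
    unfolding gibbs_measure_def by (intro prob_spaceI) (simp add: space_point_measure)
qed

lemma finite_graph_finite_edges: "finite_graph V E \<Longrightarrow> finite E"
  unfolding finite_graph_def by (meson Pow_iff finite_Pow_iff finite_subset subsetI)

lemma prob_space_potts_measure:
  assumes "finite_graph V E" "q \<ge> 1"
  shows "prob_space (potts_measure V E J \<beta>' h q)"
  unfolding potts_measure_def
proof (rule prob_space_gibbs_measure)
  show "finite (spin_configs V q)"
    using assms by (simp add: spin_configs_def finite_graph_def finite_PiE)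
  show "potts_weight V E J \<beta>' h q \<sigma> \<ge> 0" for \<sigma>
    by (simp add: potts_weight_def)
  have "(\<lambda>i\<in>V. 1) \<in> spin_configs V q"
    using assms by (auto simp: spin_configs_def)
  then show "\<exists>\<sigma>\<in>spin_configs V q. potts_weight V E J \<beta>' h q \<sigma> > 0"
    by (auto simp: potts_weight_def)
qed

lemma prob_space_random_cluster_measure:
  assumes G: "finite_graph V E" and q: "q \<ge> 1"
    and p: "\<And>e. e \<in> E \<Longrightarrow> 0 \<le> p e \<and> p e < 1"
  shows "prob_space (random_cluster_measure V E p \<beta> h q)"
  unfolding random_cluster_measure_def
proof (rule prob_space_gibbs_measure)
  show "finite (edge_configs E)"
    using finite_graph_finite_edges[OF G] by (simp add: edge_configs_def finite_PiE)
  have cl: "(\<Prod>K\<in>open_components V E \<omega>. \<Sum>s=1..q. exp (\<beta> * (\<Sum>i\<in>K. h i s))) > 0" for \<omega>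
    using q by (intro prod_pos ballI sum_pos) auto
  show "random_cluster_weight V E p \<beta> h q \<omega> \<ge> 0" for \<omega>
    unfolding random_cluster_weight_def bernoulli_factor_def
    using p by (intro mult_nonneg_nonneg prod_nonneg less_imp_le[OF cl]) (auto intro: less_imp_le)
  have "bernoulli_factor E p (\<lambda>e\<in>E. 0) > 0"
    unfolding bernoulli_factor_def using p by (intro mult_pos_pos prod_pos) auto
  then have "random_cluster_weight V E p \<beta> h q (\<lambda>e\<in>E. 0) > 0"
    unfolding random_cluster_weight_def using cl by (rule mult_pos_pos)
  moreover have "(\<lambda>e\<in>E. 0) \<in> edge_configs E"
    by (auto simp: edge_configs_def)
  ultimately show "\<exists>\<omega>\<in>edge_configs E. random_cluster_weight V E p \<beta> h q \<omega> > 0"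
    by blast
qed

end

theory Submission
  imports Defs
begin

text \<open>
  The proof sums the Edwards--Sokal weight
  \[
    W(\sigma,\omega) = \prod_{e : \omega_e = 1} p_e\,\delta_e(\sigma)
      \prod_{e : \omega_e = 0} (1 - p_e) \; \prod_{i \in V} g_i(\sigma_i)
  \]
  over pairs of a spin and an edge configuration in both orders. With \<open>\<sigma>\<close> fixed, the sum over \<open>\<omega>\<close>
  factorises over the edges, each contributing \<open>1 - p\<^sub>e + p\<^sub>e \<delta>\<^sub>e(\<sigma>)\<close>; for
  \<open>p\<^sub>e = 1 - exp (- q \<beta> J\<^sub>e)\<close> this is the Potts interaction, up to the constant
  \<open>exp (- q \<beta> J\<^sub>e)\<close>. With \<open>\<omega>\<close> fixed, only spins that are constant on open clusters survive, and
  the sum over \<open>\<sigma>\<close> factorises over the clusters. The resulting identity is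
  \<open>edwards_sokal_identity\<close>.

  It holds for arbitrary real single-site factors \<open>g\<^sub>i\<close>, and is used twice. With
  \<open>g\<^sub>i(s) = exp (\<beta> h\<^sub>i\<^sub>s)\<close> it compares the two partition functions. Multiplying
  \<open>g\<^sub>x(s)\<close> by the indicator of \<open>s = m\<close> restricts the spin side to \<open>\<sigma>\<^sub>x = m\<close>; on the cluster side it
  only affects the cluster of \<open>x\<close>, whose spin sum collapses to its \<open>m\<close>-th term. This replaces the
  random-cluster weight by its product with the stated ratio. The theorem is the quotient of
  the two instances, in which the constant \<open>exp (- q \<beta> \<Sum>\<^sub>e J\<^sub>e)\<close> cancels.
\<close>

section \<open>Finite Gibbs measures\<close>

lemma measure_gibbs_measure:
  assumes "finite \<Omega>" "\<And>\<omega>. \<omega> \<in> \<Omega> \<Longrightarrow> w \<omega> \<ge> 0" "A \<subseteq> \<Omega>"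
  shows "measure (gibbs_measure \<Omega> w) A = (\<Sum>\<omega>\<in>A. w \<omega>) / (\<Sum>\<omega>\<in>\<Omega>. w \<omega>)"
proof -
  have nn: "w \<omega> / sum w \<Omega> \<ge> 0" if "\<omega> \<in> \<Omega>" for \<omega>
    using assms that by (intro divide_nonneg_nonneg sum_nonneg) auto
  have "emeasure (gibbs_measure \<Omega> w) A = (\<Sum>\<omega>\<in>A. ennreal (w \<omega> / sum w \<Omega>))"
    using assms by (simp add: gibbs_measure_def emeasure_point_measure_finite)
  also have "\<dots> = ennreal (\<Sum>\<omega>\<in>A. w \<omega> / sum w \<Omega>)"
    using nn assms(3) by (intro sum_ennreal) auto
  also have "(\<Sum>\<omega>\<in>A. w \<omega> / sum w \<Omega>) = sum w A / sum w \<Omega>"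
    by (simp add: sum_divide_distrib)
  finally show ?thesis
    using assms by (simp add: measure_def sum_nonneg subset_iff)
qed

lemma integral_gibbs_measure:
  fixes f :: "'c \<Rightarrow> real"
  assumes "finite \<Omega>" "\<And>\<omega>. \<omega> \<in> \<Omega> \<Longrightarrow> w \<omega> \<ge> 0"
  shows "(\<integral>\<omega>. f \<omega> \<partial>gibbs_measure \<Omega> w) = (\<Sum>\<omega>\<in>\<Omega>. w \<omega> * f \<omega>) / (\<Sum>\<omega>\<in>\<Omega>. w \<omega>)"
proof -
  have "w \<omega> / sum w \<Omega> \<ge> 0" if "\<omega> \<in> \<Omega>" for \<omega>
    using assms that by (intro divide_nonneg_nonneg sum_nonneg) auto
  then have "(\<integral>\<omega>. f \<omega> \<partial>gibbs_measure \<Omega> w) = (\<Sum>\<omega>\<in>\<Omega>. w \<omega> / sum w \<Omega> * f \<omega>)"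
    using assms(1) unfolding gibbs_measure_def
    by (subst lebesgue_integral_point_measure_finite) auto
  then show ?thesis
    by (simp add: sum_divide_distrib)
qed

section \<open>Factorisation over open clusters\<close>

text \<open>
  A function on \<open>V\<close> that is constant on the fibres of \<open>c\<close> is the same as a free choice of one value
  per fibre, so distributivity of products over sums applies fibre by fibre.
\<close>

lemma sum_constant_on_fibres:
  fixes g :: "'v \<Rightarrow> 's \<Rightarrow> 'a::comm_semiring_1" and c :: "'v \<Rightarrow> 'b"
  assumes V: "finite V" and S: "finite S"
  shows "(\<Sum>\<sigma>\<in>{\<sigma> \<in> V \<rightarrow>\<^sub>E S. \<forall>i\<in>V. \<forall>j\<in>V. c i = c j \<longrightarrow> \<sigma> i = \<sigma> j}. \<Prod>i\<in>V. g i (\<sigma> i)) =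
    (\<Prod>k\<in>c ` V. \<Sum>s\<in>S. \<Prod>i\<in>{i \<in> V. c i = k}. g i s)"
    (is "sum ?f ?A = _")
proof -
  \<comment> \<open>A representative in each fibre, at which the common value is read off.\<close>
  let ?r = "inv_into V c"
  have r: "?r k \<in> V" "c (?r k) = k" if "k \<in> c ` V" for k
    using that by (auto intro: inv_into_into f_inv_into_f)
  have "(\<Prod>k\<in>c ` V. \<Sum>s\<in>S. \<Prod>i\<in>{i \<in> V. c i = k}. g i s) =
      (\<Sum>\<tau>\<in>c ` V \<rightarrow>\<^sub>E S. \<Prod>k\<in>c ` V. \<Prod>i\<in>{i \<in> V. c i = k}. g i (\<tau> k))"
    using V S by (subst prod_sum_PiE) auto
  also have "\<dots> = (\<Sum>\<tau>\<in>c ` V \<rightarrow>\<^sub>E S. \<Prod>i\<in>V. g i (\<tau> (c i)))"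
  proof (rule sum.cong[OF refl])
    fix \<tau>
    have "(\<Prod>k\<in>c ` V. \<Prod>i\<in>{i \<in> V. c i = k}. g i (\<tau> k)) =
        (\<Prod>k\<in>c ` V. \<Prod>i\<in>{i \<in> V. c i = k}. g i (\<tau> (c i)))"
      by (intro prod.cong) auto
    also have "\<dots> = (\<Prod>i\<in>V. g i (\<tau> (c i)))"
      by (rule prod.image_gen[OF V, symmetric])
    finally show "(\<Prod>k\<in>c ` V. \<Prod>i\<in>{i \<in> V. c i = k}. g i (\<tau> k)) = (\<Prod>i\<in>V. g i (\<tau> (c i)))" .
  qed
  also have "\<dots> = sum ?f ?A"
  proof (rule sum.reindex_bij_witness[where
        j = "\<lambda>\<tau>. \<lambda>i\<in>V. \<tau> (c i)" and i = "\<lambda>\<sigma>. \<lambda>k\<in>c ` V. \<sigma> (?r k)"])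
    fix \<tau> assume \<tau>: "\<tau> \<in> c ` V \<rightarrow>\<^sub>E S"
    show "(\<lambda>k\<in>c ` V. (\<lambda>i\<in>V. \<tau> (c i)) (?r k)) = \<tau>"
      using \<tau> r by (intro PiE_ext[OF _ \<tau>]) (auto simp: PiE_iff)
    show "(\<lambda>i\<in>V. \<tau> (c i)) \<in> ?A"
      using \<tau> by (auto simp: PiE_iff)
    show "?f (\<lambda>i\<in>V. \<tau> (c i)) = (\<Prod>i\<in>V. g i (\<tau> (c i)))"
      by (intro prod.cong) auto
  next
    fix \<sigma> assume \<sigma>: "\<sigma> \<in> ?A"
    then have \<sigma>': "\<sigma> \<in> V \<rightarrow>\<^sub>E S"
      by blast
    show mem: "(\<lambda>k\<in>c ` V. \<sigma> (?r k)) \<in> c ` V \<rightarrow>\<^sub>E S"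
      using \<sigma>' r by (auto simp: PiE_iff)
    have \<sigma>_r: "\<sigma> (?r (c i)) = \<sigma> i" if "i \<in> V" for i
    proof -
      have "?r (c i) \<in> V" "c (?r (c i)) = c i"
        using r that by blast+
      then show ?thesis
        using \<sigma> that by blast
    qed
    show "(\<lambda>i\<in>V. (\<lambda>k\<in>c ` V. \<sigma> (?r k)) (c i)) = \<sigma>"
    proof (rule PiE_ext[OF _ \<sigma>'])
      show "(\<lambda>i\<in>V. (\<lambda>k\<in>c ` V. \<sigma> (?r k)) (c i)) \<in> V \<rightarrow>\<^sub>E S"
        using \<sigma>' by (auto simp: PiE_iff \<sigma>_r)
    qed (simp add: \<sigma>_r)
  qed
  finally show ?thesis ..
qed

lemma open_component_eq_iff:
  assumes "i \<in> V" "j \<in> V"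
  shows "open_component V E \<omega> i = open_component V E \<omega> j \<longleftrightarrow> j \<in> open_component V E \<omega> i"
proof -
  let ?R = "{(i, j). {i, j} \<in> open_edges E \<omega>}\<^sup>*"
  have "sym ?R"
    by (intro sym_rtrancl) (auto simp: sym_def insert_commute)
  then show ?thesis
    using assms unfolding open_component_def
    by (auto dest: symD intro: rtrancl_trans)
qed

lemma open_component_fibre:
  assumes "x \<in> V"
  shows "{i \<in> V. open_component V E \<omega> i = open_component V E \<omega> x} = open_component V E \<omega> x"
proof -
  have "open_component V E \<omega> x \<subseteq> V"
    by (auto simp: open_component_def)
  then show ?thesis
    using open_component_eq_iff[OF assms] by blast
qed

text \<open>
  Agreement along the open edges propagates along open paths; conversely, the ends of an
  open edge share a cluster.
\<close>

lemma constant_on_open_edges_iff_on_components: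
  assumes "finite_graph V E"
  shows "(\<forall>e\<in>open_edges E \<omega>. edge_delta \<sigma> e = 1) \<longleftrightarrow>
    (\<forall>i\<in>V. \<forall>j\<in>V. open_component V E \<omega> i = open_component V E \<omega> j \<longrightarrow> \<sigma> i = \<sigma> j)"
    (is "?L' \<longleftrightarrow> ?R")
proof -
  have "?L' \<longleftrightarrow> (\<forall>e\<in>open_edges E \<omega>. \<forall>i\<in>e. \<forall>j\<in>e. \<sigma> i = \<sigma> j)"
    (is "_ \<longleftrightarrow> ?L")
    unfolding edge_delta_def of_bool_eq_1_iff ..
  also have "?L \<longleftrightarrow> ?R"
  proof
    assume L: ?L
    have "\<sigma> i = \<sigma> j" if "(i, j) \<in> {(i, j). {i, j} \<in> open_edges E \<omega>}\<^sup>*" for i j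
      using that by (induction rule: rtrancl_induct) (use L in auto)
    then show ?R
      by (auto simp: open_component_eq_iff open_component_def)
  next
    assume R: ?R
    show ?L
    proof (intro ballI)
      fix e i j assume e: "e \<in> open_edges E \<omega>" and ij: "i \<in> e" "j \<in> e"
      then have eV: "e \<subseteq> V" "card e = 2"
        using assms by (auto simp: finite_graph_def open_edges_def)
      show "\<sigma> i = \<sigma> j"
      proof (cases "i = j")
        case False
        then have "e = {i, j}"
          using eV(2) ij by (auto simp: card_2_iff)
        then have "j \<in> open_component V E \<omega> i"
          using e eV ij by (auto simp: open_component_def)
        then show ?thesis
          using R eV ij by (auto simp: open_component_eq_iff)
      qed simp
    qed
  qed
  finally show ?thesis .
qed

section \<open>Factorisation over edges\<close>

lemma bernoulli_factor_eq_prod: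
  assumes "finite E" "\<omega> \<in> edge_configs E"
  shows "bernoulli_factor E p \<omega> = (\<Prod>e\<in>E. if \<omega> e = 1 then p e else 1 - p e)"
proof -
  have "{e \<in> E. \<omega> e = 0} = {e \<in> E. \<omega> e \<noteq> 1}"
    using assms by (auto simp: edge_configs_def PiE_iff)
  moreover have "(\<Prod>e\<in>E. if \<omega> e = 1 then p e else 1 - p e) =
      prod p (E \<inter> {e. \<omega> e = 1}) * prod (\<lambda>e. 1 - p e) (E \<inter> - {e. \<omega> e = 1})"
    using assms(1) by (rule prod.If_cases)
  ultimately show ?thesis
    by (simp add: bernoulli_factor_def Int_def Compl_eq)
qed

lemma edge_delta_cases: "edge_delta \<sigma> e = 0 \<or> edge_delta \<sigma> e = 1"
  unfolding edge_delta_def of_bool_eq_0_iff of_bool_eq_1_iff by (rule excluded_middle)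

text \<open>
  For fixed spins the edges are independent: a closed edge weighs \<open>1 - p\<^sub>e\<close>, and an open one \<open>p\<^sub>e\<close> if
  its ends agree and \<open>0\<close> otherwise.
\<close>

lemma sum_bernoulli_factor_compatible:
  assumes "finite E"
  shows "(\<Sum>\<omega>\<in>edge_configs E. bernoulli_factor E p \<omega> *
      of_bool (\<forall>e\<in>open_edges E \<omega>. edge_delta \<sigma> e = 1)) =
    (\<Prod>e\<in>E. 1 - p e + p e * edge_delta \<sigma> e)"
proof -
  define u where "u e a = (if a = 1 then p e * edge_delta \<sigma> e else 1 - p e)" for e and a :: nat
  have "bernoulli_factor E p \<omega> * of_bool (\<forall>e\<in>open_edges E \<omega>. edge_delta \<sigma> e = 1) =
      (\<Prod>e\<in>E. u e (\<omega> e))" if "\<omega> \<in> edge_configs E" for \<omega>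
  proof -
    have "of_bool (\<forall>e\<in>open_edges E \<omega>. edge_delta \<sigma> e = 1) =
        (\<Prod>e\<in>E. if \<omega> e = 1 then edge_delta \<sigma> e else 1)"
    proof (cases "\<forall>e\<in>open_edges E \<omega>. edge_delta \<sigma> e = 1")
      case True
      then have "(\<Prod>e\<in>E. if \<omega> e = 1 then edge_delta \<sigma> e else 1) = 1"
        by (intro prod.neutral) (auto simp: open_edges_def)
      then show ?thesis
        using True by simp
    next
      case False
      then obtain e where e: "e \<in> E" "\<omega> e = 1" "edge_delta \<sigma> e \<noteq> 1"
        by (auto simp: open_edges_def)
      then have "edge_delta \<sigma> e = 0"
        using edge_delta_cases by blast
      then have "(\<Prod>e\<in>E. if \<omega> e = 1 then edge_delta \<sigma> e else 1) = 0"
        using assms e by (intro prod_zero) auto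
      then show ?thesis
        using False by simp
    qed
    then show ?thesis
      unfolding bernoulli_factor_eq_prod[OF assms that]
      by (simp only: prod.distrib[symmetric]) (intro prod.cong refl, simp add: u_def)
  qed
  then have "(\<Sum>\<omega>\<in>edge_configs E. bernoulli_factor E p \<omega> *
      of_bool (\<forall>e\<in>open_edges E \<omega>. edge_delta \<sigma> e = 1)) =
      (\<Sum>\<omega>\<in>E \<rightarrow>\<^sub>E {0, 1}. \<Prod>e\<in>E. u e (\<omega> e))"
    by (simp add: edge_configs_def)
  also have "\<dots> = (\<Prod>e\<in>E. \<Sum>a\<in>{0, 1}. u e a)"
    using assms by (subst prod_sum_PiE) auto
  also have "\<dots> = (\<Prod>e\<in>E. 1 - p e + p e * edge_delta \<sigma> e)"
    by (simp add: u_def)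
  finally show ?thesis .
qed

section \<open>The Edwards--Sokal identity and the Potts weight\<close>

text \<open>
  Both sides are the total weight of the pairs \<open>(\<sigma>, \<omega>)\<close> in which every open edge joins equal
  spins, summed over \<open>\<sigma>\<close> first on the left and over \<open>\<omega>\<close> first on the right.
\<close>

lemma edwards_sokal_identity:
  fixes g :: "'v \<Rightarrow> nat \<Rightarrow> real"
  assumes G: "finite_graph V E"
  shows "(\<Sum>\<omega>\<in>edge_configs E. bernoulli_factor E p \<omega> *
      (\<Prod>K\<in>open_components V E \<omega>. \<Sum>s=1..q. \<Prod>i\<in>K. g i s)) =
    (\<Sum>\<sigma>\<in>spin_configs V q. (\<Prod>e\<in>E. 1 - p e + p e * edge_delta \<sigma> e) * (\<Prod>i\<in>V. g i (\<sigma> i)))"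
proof -
  let ?comp = "\<lambda>\<sigma> \<omega>. \<forall>e\<in>open_edges E \<omega>. edge_delta \<sigma> e = 1"
  have V: "finite V" and E: "finite E"
    using G finite_graph_finite_edges by (auto simp: finite_graph_def)
  have fin: "finite (spin_configs V q)"
    using V by (simp add: spin_configs_def finite_PiE)
  have "(\<Prod>K\<in>open_components V E \<omega>. \<Sum>s=1..q. \<Prod>i\<in>K. g i s) =
      (\<Sum>\<sigma>\<in>spin_configs V q. of_bool (?comp \<sigma> \<omega>) * (\<Prod>i\<in>V. g i (\<sigma> i)))" for \<omega>
  proof -
    have "(\<Prod>K\<in>open_components V E \<omega>. \<Sum>s=1..q. \<Prod>i\<in>K. g i s) =
        (\<Prod>K\<in>open_component V E \<omega> ` V. \<Sum>s=1..q.
          \<Prod>i\<in>{i \<in> V. open_component V E \<omega> i = K}. g i s)"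
      unfolding open_components_def by (intro prod.cong) (auto simp: open_component_fibre)
    also have "\<dots> = (\<Sum>\<sigma>\<in>{\<sigma> \<in> spin_configs V q. ?comp \<sigma> \<omega>}. \<Prod>i\<in>V. g i (\<sigma> i))"
      unfolding constant_on_open_edges_iff_on_components[OF G] spin_configs_def
      by (rule sum_constant_on_fibres[symmetric]) (use V in auto)
    also have "\<dots> = (\<Sum>\<sigma>\<in>spin_configs V q. of_bool (?comp \<sigma> \<omega>) * (\<Prod>i\<in>V. g i (\<sigma> i)))"
      using fin by (intro sum.mono_neutral_cong_left) auto
    finally show ?thesis .
  qed
  then have "(\<Sum>\<omega>\<in>edge_configs E. bernoulli_factor E p \<omega> *
      (\<Prod>K\<in>open_components V E \<omega>. \<Sum>s=1..q. \<Prod>i\<in>K. g i s)) =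
      (\<Sum>\<omega>\<in>edge_configs E. \<Sum>\<sigma>\<in>spin_configs V q.
        bernoulli_factor E p \<omega> * of_bool (?comp \<sigma> \<omega>) * (\<Prod>i\<in>V. g i (\<sigma> i)))"
    by (simp only: sum_distrib_left mult.assoc)
  also have "\<dots> = (\<Sum>\<sigma>\<in>spin_configs V q. (\<Sum>\<omega>\<in>edge_configs E.
        bernoulli_factor E p \<omega> * of_bool (?comp \<sigma> \<omega>)) * (\<Prod>i\<in>V. g i (\<sigma> i)))"
    by (subst sum.swap) (simp only: sum_distrib_right)
  finally show ?thesis
    by (simp only: sum_bernoulli_factor_compatible[OF E])
qed

text \<open>
  With \<open>p\<^sub>e = 1 - exp (- q \<beta> J\<^sub>e)\<close>, the edge factor is \<open>1 = exp (- q \<beta> J\<^sub>e) exp (q \<beta> J\<^sub>e)\<close> when the ends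
  agree and \<open>exp (- q \<beta> J\<^sub>e)\<close> when they do not. The \<open>1 / q\<close> in the Potts field cancels the \<open>q\<close> in the
  inverse temperature \<open>q \<beta>\<close>.
\<close>

lemma edge_site_product_eq_potts_weight:
  assumes "finite V" "finite E" "q \<ge> 1" and \<sigma>: "\<sigma> \<in> spin_configs V q"
    and p: "\<And>e. e \<in> E \<Longrightarrow> p e = 1 - exp (- (real q * \<beta> * J e))"
  shows "(\<Prod>e\<in>E. 1 - p e + p e * edge_delta \<sigma> e) * (\<Prod>i\<in>V. exp (\<beta> * h i (\<sigma> i))) =
    exp (- (real q * \<beta> * (\<Sum>e\<in>E. J e))) * potts_weight V E J (real q * \<beta>) h q \<sigma>"
proof -
  have "(\<Prod>e\<in>E. 1 - p e + p e * edge_delta \<sigma> e) =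
      (\<Prod>e\<in>E. exp (- (real q * \<beta> * J e) + real q * \<beta> * (J e * edge_delta \<sigma> e)))"
    by (intro prod.cong refl) (simp add: p edge_delta_def flip: exp_minus)
  also have "\<dots> = exp (- (real q * \<beta> * (\<Sum>e\<in>E. J e))
      + real q * \<beta> * (\<Sum>e\<in>E. J e * edge_delta \<sigma> e))"
    by (simp only: exp_sum[OF assms(2), symmetric] sum.distrib sum_negf sum_distrib_left)
  finally have edges: "(\<Prod>e\<in>E. 1 - p e + p e * edge_delta \<sigma> e) = \<dots>" .
  have "(\<Sum>s=1..q. \<Sum>i\<in>V. h i s / real q * of_bool (\<sigma> i = s)) =
      (\<Sum>i\<in>V. \<Sum>s=1..q. h i s / real q * of_bool (\<sigma> i = s))"
    by (rule sum.swap)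
  also have "\<dots> = (\<Sum>i\<in>V. h i (\<sigma> i) / real q)"
  proof (rule sum.cong[OF refl])
    fix i assume "i \<in> V"
    then have i: "\<sigma> i \<in> {1..q}"
      using \<sigma> by (auto simp: spin_configs_def)
    have "(\<Sum>s=1..q. h i s / real q * of_bool (\<sigma> i = s)) =
        (\<Sum>s=1..q. if \<sigma> i = s then h i s / real q else 0)"
      by (intro sum.cong) auto
    then show "(\<Sum>s=1..q. h i s / real q * of_bool (\<sigma> i = s)) = h i (\<sigma> i) / real q"
      using i by (simp add: sum.delta')
  qed
  finally have "real q * \<beta> * (\<Sum>s=1..q. \<Sum>i\<in>V. h i s / real q * of_bool (\<sigma> i = s)) =
      (\<Sum>i\<in>V. \<beta> * h i (\<sigma> i))"
    using assms(3) by (simp add: sum_distrib_left)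
  then show ?thesis
    unfolding edges potts_weight_def exp_sum[OF assms(1), symmetric] exp_add
    by (simp only: mult.assoc)
qed

section \<open>The one-point marginal of the Potts measure\<close>

theorem proposition3:
  fixes V :: "'v set" and E :: "'v set set" and x :: 'v and q m :: nat
    and \<beta> :: real and J p :: "'v set \<Rightarrow> real" and h :: "'v \<Rightarrow> nat \<Rightarrow> real"
  assumes "finite_graph V E" and "x \<in> V" and "q \<ge> 1" and "\<beta> > 0"
    and "\<And>e. e \<in> E \<Longrightarrow> J e \<ge> 0"
    and "\<And>e. e \<in> E \<Longrightarrow> p e = 1 - exp (- (real q * \<beta> * J e))"
    and "m \<in> {1..q}"
  shows "measure (potts_measure V E J (real q * \<beta>) h q) {\<sigma> \<in> spin_configs V q. \<sigma> x = m} =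
    (\<integral>\<omega>. exp (\<beta> * (\<Sum>i\<in>open_component V E \<omega> x. h i m)) /
         (\<Sum>s=1..q. exp (\<beta> * (\<Sum>i\<in>open_component V E \<omega> x. h i s)))
      \<partial>random_cluster_measure V E p \<beta> h q)"
proof -
  note G = assms(1) and x = assms(2) and q = assms(3) and p = assms(6) and m = assms(7)
  have V: "finite V" and E: "finite E"
    using G finite_graph_finite_edges by (auto simp: finite_graph_def)
  have finS: "finite (spin_configs V q)" and finO: "finite (edge_configs E)"
    using V E by (simp_all add: spin_configs_def edge_configs_def finite_PiE)
  have finK: "finite K" if "K \<in> open_components V E \<omega>" for K \<omega>
    using that V by (auto simp: open_components_def open_component_def)
  let ?RC = "random_cluster_weight V E p \<beta> h q"
  let ?P = "potts_weight V E J (real q * \<beta>) h q"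
  let ?Sm = "{\<sigma> \<in> spin_configs V q. \<sigma> x = m}"
  let ?C = "exp (- (real q * \<beta> * (\<Sum>e\<in>E. J e)))"
  let ?edges = "\<lambda>\<sigma>. \<Prod>e\<in>E. 1 - p e + p e * edge_delta \<sigma> e"
  let ?F = "\<lambda>\<omega>. exp (\<beta> * (\<Sum>i\<in>open_component V E \<omega> x. h i m)) /
         (\<Sum>s=1..q. exp (\<beta> * (\<Sum>i\<in>open_component V E \<omega> x. h i s)))"
  define g where "g i s = exp (\<beta> * h i s)" for i s
  \<comment> \<open>The single-site factors that pin the spin at \<open>x\<close> to \<open>m\<close>.\<close>
  define g' where "g' i s = g i s * of_bool (i = x \<longrightarrow> s = m)" for i s
  have g_prod: "(\<Prod>i\<in>K. g i s) = exp (\<beta> * (\<Sum>i\<in>K. h i s))" if "finite K" for K s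
    using that by (simp add: g_def exp_sum sum_distrib_left)
  have potts: "?edges \<sigma> * (\<Prod>i\<in>V. g i (\<sigma> i)) = ?C * ?P \<sigma>" if "\<sigma> \<in> spin_configs V q" for \<sigma>
    unfolding g_def by (rule edge_site_product_eq_potts_weight[OF V E q that p])

  have RC: "?RC \<omega> = bernoulli_factor E p \<omega> *
      (\<Prod>K\<in>open_components V E \<omega>. \<Sum>s=1..q. \<Prod>i\<in>K. g i s)" for \<omega>
    by (simp add: random_cluster_weight_def g_prod finK)
  have Z: "(\<Sum>\<omega>\<in>edge_configs E. ?RC \<omega>) = ?C * (\<Sum>\<sigma>\<in>spin_configs V q. ?P \<sigma>)"
    unfolding RC edwards_sokal_identity[OF G] by (simp add: potts sum_distrib_left)

  have RC': "?RC \<omega> * ?F \<omega> = bernoulli_factor E p \<omega> *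
      (\<Prod>K\<in>open_components V E \<omega>. \<Sum>s=1..q. \<Prod>i\<in>K. g' i s)" for \<omega>
  proof -
    let ?K = "open_component V E \<omega> x" and ?Ks = "open_components V E \<omega>"
    have K: "?K \<in> ?Ks" and finKs: "finite ?Ks"
      using x V by (auto simp: open_components_def)
    have xK: "x \<in> ?K"
      using x by (simp add: open_component_def)
    \<comment> \<open>Distinct clusters are disjoint, so the pinning is felt by the cluster of \<open>x\<close> alone.\<close>
    have x_other: "x \<notin> K" if K': "K \<in> ?Ks - {?K}" for K
    proof -
      obtain y where y: "y \<in> V" "K = open_component V E \<omega> y" "K \<noteq> ?K"
        using K' by (auto simp: open_components_def)
      then show ?thesis
        using open_component_eq_iff[OF y(1) x] by metis
    qed
    have other: "(\<Prod>i\<in>K. g' i s) = (\<Prod>i\<in>K. g i s)" if "K \<in> ?Ks - {?K}" for K s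
      using x_other[OF that] by (intro prod.cong) (auto simp: g'_def)
    have "(\<Prod>i\<in>?K. g' i s) = (if s = m then \<Prod>i\<in>?K. g i m else 0)" for s
    proof (cases "s = m")
      case True
      then have "(\<Prod>i\<in>?K. g' i s) = (\<Prod>i\<in>?K. g i m)"
        by (intro prod.cong) (simp_all add: g'_def)
      then show ?thesis
        using True by simp
    next
      case False
      then have "g' x s = 0"
        by (simp add: g'_def)
      then show ?thesis
        using False prod_zero[OF finK[OF K], of "\<lambda>i. g' i s"] xK by auto
    qed
    then have own: "(\<Sum>s=1..q. \<Prod>i\<in>?K. g' i s) = (\<Prod>i\<in>?K. g i m)"
      using m by simp
    have pos: "(\<Sum>s=1..q. \<Prod>i\<in>?K. g i s) > 0"
      using q by (intro sum_pos prod_pos) (auto simp: g_def)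
    have F: "?F \<omega> = (\<Prod>i\<in>?K. g i m) / (\<Sum>s=1..q. \<Prod>i\<in>?K. g i s)"
      by (simp add: g_prod finK[OF K])
    let ?a = "\<lambda>K. \<Sum>s=1..q. \<Prod>i\<in>K. g i s" and ?a' = "\<lambda>K. \<Sum>s=1..q. \<Prod>i\<in>K. g' i s"
    have "(\<Prod>K\<in>?Ks. ?a' K) = ?a' ?K * (\<Prod>K\<in>?Ks - {?K}. ?a' K)"
      by (rule prod.remove[OF finKs K])
    also have "(\<Prod>K\<in>?Ks - {?K}. ?a' K) = (\<Prod>K\<in>?Ks - {?K}. ?a K)"
      by (intro prod.cong sum.cong refl other)
    also have "?a' ?K * (\<Prod>K\<in>?Ks - {?K}. ?a K) =
        (?a ?K * (\<Prod>K\<in>?Ks - {?K}. ?a K)) * ((\<Prod>i\<in>?K. g i m) / ?a ?K)"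
      unfolding own using pos by simp
    also have "?a ?K * (\<Prod>K\<in>?Ks - {?K}. ?a K) = (\<Prod>K\<in>?Ks. ?a K)"
      by (rule prod.remove[OF finKs K, symmetric])
    finally have swap: "(\<Prod>K\<in>?Ks. ?a' K) = (\<Prod>K\<in>?Ks. ?a K) * ((\<Prod>i\<in>?K. g i m) / ?a ?K)" .
    show ?thesis
      by (simp only: RC F swap mult.assoc)
  qed
  have "(\<Sum>\<omega>\<in>edge_configs E. ?RC \<omega> * ?F \<omega>) =
      (\<Sum>\<sigma>\<in>spin_configs V q. ?edges \<sigma> * (\<Prod>i\<in>V. g' i (\<sigma> i)))"
    unfolding RC' by (rule edwards_sokal_identity[OF G])
  also have "\<dots> = (\<Sum>\<sigma>\<in>?Sm. ?C * ?P \<sigma>)"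
  proof (rule sum.mono_neutral_cong_right[OF finS])
    show "?Sm \<subseteq> spin_configs V q"
      by blast
    show "\<forall>\<sigma>\<in>spin_configs V q - ?Sm. ?edges \<sigma> * (\<Prod>i\<in>V. g' i (\<sigma> i)) = 0"
    proof
      fix \<sigma> assume "\<sigma> \<in> spin_configs V q - ?Sm"
      then have "g' x (\<sigma> x) = 0"
        by (simp add: g'_def)
      then have "(\<Prod>i\<in>V. g' i (\<sigma> i)) = 0"
        using V x by (intro prod_zero) auto
      then show "?edges \<sigma> * (\<Prod>i\<in>V. g' i (\<sigma> i)) = 0"
        by simp
    qed
  next
    fix \<sigma> assume \<sigma>: "\<sigma> \<in> ?Sm"
    then have "(\<Prod>i\<in>V. g' i (\<sigma> i)) = (\<Prod>i\<in>V. g i (\<sigma> i))"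
      by (intro prod.cong) (auto simp: g'_def)
    then show "?edges \<sigma> * (\<Prod>i\<in>V. g' i (\<sigma> i)) = ?C * ?P \<sigma>"
      using \<sigma> potts by simp
  qed
  also have "\<dots> = ?C * (\<Sum>\<sigma>\<in>?Sm. ?P \<sigma>)"
    by (simp add: sum_distrib_left)
  finally have N: "(\<Sum>\<omega>\<in>edge_configs E. ?RC \<omega> * ?F \<omega>) = ?C * (\<Sum>\<sigma>\<in>?Sm. ?P \<sigma>)" .

  have p01: "0 \<le> p e" "p e \<le> 1" if "e \<in> E" for e
    using that assms(4,5) by (auto simp: p)
  have RC_nonneg: "?RC \<omega> \<ge> 0" for \<omega>
    unfolding random_cluster_weight_def bernoulli_factor_def
    using p01 by (intro mult_nonneg_nonneg prod_nonneg sum_nonneg) auto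
  have "measure (potts_measure V E J (real q * \<beta>) h q) ?Sm =
      (\<Sum>\<sigma>\<in>?Sm. ?P \<sigma>) / (\<Sum>\<sigma>\<in>spin_configs V q. ?P \<sigma>)"
    unfolding potts_measure_def
    by (rule measure_gibbs_measure[OF finS]) (auto simp: potts_weight_def)
  also have "\<dots> = (\<Sum>\<omega>\<in>edge_configs E. ?RC \<omega> * ?F \<omega>) / (\<Sum>\<omega>\<in>edge_configs E. ?RC \<omega>)"
    unfolding N Z by simp
  also have "\<dots> = (\<integral>\<omega>. ?F \<omega> \<partial>random_cluster_measure V E p \<beta> h q)"
    unfolding random_cluster_measure_def
    by (rule integral_gibbs_measure[OF finO RC_nonneg, symmetric])
  finally show ?thesis .
qed

end
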